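(* For each infinite cardinal $\kappa$, there is an uncountable Hausdorff ccc space $X$ such that no uncountable subspace $Y\subseteq X$ with $|Y|<2^\kappa$ is ccc (in the subspace topology).
   Context: A topological space $(X,\tau)$ is ccc (has the countable chain condition) if for any uncountable $\mathcal{F}\subseteq\tau$ there are distinct $U,V\in\mathcal{F}$ with $U\cap V\neq\emptyset$. *)

theory Defs
  imports "HOL-Analysis.Analysis"
begin

unbundle cardinal_syntax

definition ccc_space :: "'a topology \<Rightarrow> bool" where
  "ccc_space X \<longleftrightarrow>
     (\<forall>\<F>. \<F> \<subseteq> {U. openin X U} \<and> uncountable \<F> \<longrightarrow>
        (\<exists>U\<in>\<F>. \<exists>V\<in>\<F>. U \<noteq> V \<and> U \<inter> V \<noteq> {}))"

end

theory Submission
  imports Defs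
begin

text \<open>
  The space is the Cantor cube \<open>2\<^sup>\<kappa>\<close>, realised as the power set of \<open>K = Field \<kappa>\<close>, with its
  product topology refined by declaring every set of fewer than \<open>2\<^sup>\<kappa>\<close> points to be closed.
  All subsets of a set of fewer than \<open>2\<^sup>\<kappa>\<close> points are then closed, so every subspace of that
  size is discrete (\<open>openin_thick_isolate\<close>), and an uncountable discrete space is not ccc. The
  refined topology is still Hausdorff, being finer than the product topology.

  The point is that the refinement does not destroy ccc. Every nonempty basic open set of the cube
  has \<open>2\<^sup>\<kappa>\<close> points (\<open>card_cyl\<close>), so removing fewer than \<open>2\<^sup>\<kappa>\<close> points from each of two basic open
  sets that meet cannot make them disjoint. Hence pairwise disjoint open sets of the refinement
  yield pairwise disjoint cylinders. A cylinder that prescribes \<open>n\<close> coordinates has measure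
  \<open>2\<^sup>-\<^sup>n\<close>, so at most \<open>2\<^sup>n\<close> of them can be pairwise disjoint
  (\<open>cylinders_overlap\<close>); an uncountable family would contain infinitely many for a single \<open>n\<close>.
\<close>

section \<open>Cylinders in the Cantor cube\<close>

definition cyl :: "'k set \<Rightarrow> 'k set \<Rightarrow> 'k set \<Rightarrow> 'k set set" where
  "cyl K S F = {T. T \<subseteq> K \<and> T \<inter> F = S \<inter> F}"

lemma bij_betw_cyl:
  assumes "S \<inter> F \<subseteq> K"
  shows "bij_betw (\<lambda>T. T \<union> S \<inter> F) (Pow (K - F)) (cyl K S F)"
proof (rule bij_betw_byWitness[where f' = "\<lambda>T. T - F"])
  show "\<forall>T\<in>Pow (K - F). T \<union> S \<inter> F - F = T"
    by blast
  show "\<forall>T\<in>cyl K S F. T - F \<union> S \<inter> F = T"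
    unfolding cyl_def by blast
  show "(\<lambda>T. T \<union> S \<inter> F) ` Pow (K - F) \<subseteq> cyl K S F"
    using assms unfolding cyl_def by blast
  show "(\<lambda>T. T - F) ` cyl K S F \<subseteq> Pow (K - F)"
    unfolding cyl_def by blast
qed

text \<open>
  Each member of the family below takes up the same fraction \<open>2\<^sup>-\<^sup>n\<close> of the finite cube
  \<open>Pow G\<close>, where \<open>G\<close> is the set of all coordinates involved; this replaces the product measure.
\<close>

lemma cylinders_overlap:
  fixes F S :: "'i \<Rightarrow> 'k set"
  assumes "finite I" and fin: "\<And>i. i \<in> I \<Longrightarrow> finite (F i)"
    and card: "\<And>i. i \<in> I \<Longrightarrow> card (F i) = n" and many: "2 ^ n < card I"
  obtains i j T where "i \<in> I" "j \<in> I" "i \<noteq> j" "T \<inter> F i = S i \<inter> F i" "T \<inter> F j = S j \<inter> F j"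
proof (rule ccontr)
  assume neg: "\<not> thesis"
  define G where "G = (\<Union>i\<in>I. F i)"
  have finG: "finite G"
    using assms by (auto simp: G_def)
  define C where "C i = cyl G (S i) (F i)" for i
  have cardC: "card (C i) * 2 ^ n = 2 ^ card G" if "i \<in> I" for i
  proof -
    have sub: "F i \<subseteq> G"
      using that by (auto simp: G_def)
    have "bij_betw (\<lambda>T. T \<union> S i \<inter> F i) (Pow (G - F i)) (C i)"
      unfolding C_def using sub by (intro bij_betw_cyl) blast
    then have "card (C i) = 2 ^ card (G - F i)"
      using finG by (simp add: bij_betw_same_card[symmetric] card_Pow)
    moreover have "card G = card (G - F i) + n"
      using sub finG card[OF that] fin[OF that]
      by (metis card_Diff_subset card_mono le_add_diff_inverse2)
    ultimately show ?thesis
      by (simp add: power_add)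
  qed
  have "card (\<Union>i\<in>I. C i) = (\<Sum>i\<in>I. card (C i))"
  proof (rule card_UN_disjoint)
    show "\<forall>i\<in>I. finite (C i)"
      using finG by (auto simp: C_def cyl_def intro: finite_subset[of _ "Pow G"])
    show "\<forall>i\<in>I. \<forall>j\<in>I. i \<noteq> j \<longrightarrow> C i \<inter> C j = {}"
      using neg that by (auto simp: C_def cyl_def)
  qed (use assms in auto)
  moreover have "card (\<Union>i\<in>I. C i) \<le> card (Pow G)"
    by (rule card_mono) (use finG in \<open>auto simp: C_def cyl_def\<close>)
  ultimately have "(\<Sum>i\<in>I. card (C i)) * 2 ^ n \<le> 2 ^ card G * 2 ^ n"
    using finG by (simp add: card_Pow)
  moreover have "(\<Sum>i\<in>I. card (C i)) * 2 ^ n = card I * 2 ^ card G"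
    using cardC by (simp add: sum_distrib_right)
  ultimately show False
    using many by simp
qed

text \<open>
  The coordinates in \<open>K - F\<close> remain free, and removing finitely many coordinates from an infinite
  set does not change its cardinality.
\<close>

lemma card_cyl:
  assumes "infinite K" "finite F" "S \<subseteq> K"
  shows "|cyl K S F| =o |Pow K|"
proof -
  have "|K - F| =o |K|"
  proof (rule ccontr)
    assume "\<not> ?thesis"
    then have "|K - F| <o |K|"
      using card_of_mono1[OF Diff_subset] ordLeq_iff_ordLess_or_ordIso by blast
    moreover have "|F| <o |K|"
      using assms card_of_ordLeq_finite ordLess_or_ordLeq card_of_Well_order by metis
    ultimately have "|(K - F) \<union> F| <o |K|"
      by (rule card_of_Un_ordLess_infinite[OF assms(1)])
    moreover have "|K| \<le>o |(K - F) \<union> F|"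
      by (rule card_of_mono1) blast
    ultimately show False
      using not_ordLess_ordLeq by blast
  qed
  then obtain f where f: "bij_betw f (K - F) K"
    using card_of_ordIso by blast
  have "bij_betw (\<lambda>T. T \<union> S \<inter> F) (Pow (K - F)) (cyl K S F)"
    using assms by (intro bij_betw_cyl) blast
  then have "|Pow (K - F)| =o |cyl K S F|"
    using card_of_ordIso by blast
  moreover have "|Pow (K - F)| =o |Pow K|"
    using bij_betw_Pow[OF f] card_of_ordIso by blast
  ultimately show ?thesis
    using ordIso_symmetric ordIso_transitive by blast
qed

section \<open>The refined topology\<close>

text \<open>
  This is the topology with base the sets \<open>cyl K S F - N\<close>, for \<open>F\<close> finite and \<open>N\<close> of fewer than
  \<open>2\<^bsup>|K|\<^esup>\<close> points. Letting the set \<open>N\<close> around a point of \<open>W\<close> be \<open>cyl K S F - W\<close> removes it from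
  the quantifier.
\<close>

definition thick_open :: "'k set \<Rightarrow> 'k set set \<Rightarrow> bool" where
  "thick_open K W \<longleftrightarrow>
     W \<subseteq> Pow K \<and> (\<forall>S\<in>W. \<exists>F. finite F \<and> |cyl K S F - W| <o |Pow K| )"

definition thick_cube :: "'k set \<Rightarrow> 'k set topology" where
  "thick_cube K = topology (thick_open K)"

text \<open>
  This is what makes \<open>thick_open\<close> closed under binary intersections.
\<close>

lemma small_Un:
  assumes "infinite K" "|M| <o |Pow K|" "|N| <o |Pow K|"
  shows "|M \<union> N| <o |Pow K|"
  using assms by (intro card_of_Un_ordLess_infinite) auto

lemma small_subset: "M \<subseteq> N \<Longrightarrow> |N| <o |Pow K| \<Longrightarrow> |M| <o |Pow K|"
  using card_of_mono1 ordLeq_ordLess_trans by blast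

lemma openin_thick_cube:
  assumes "infinite K"
  shows "openin (thick_cube K) W \<longleftrightarrow> thick_open K W"
proof -
  have "istopology (thick_open K)"
    unfolding istopology_def
  proof (intro conjI allI impI)
    fix W V assume W: "thick_open K W" and V: "thick_open K V"
    show "thick_open K (W \<inter> V)"
      unfolding thick_open_def
    proof (intro conjI ballI)
      show "W \<inter> V \<subseteq> Pow K"
        using W by (auto simp: thick_open_def)
      fix S assume "S \<in> W \<inter> V"
      then obtain F G where "finite F" "|cyl K S F - W| <o |Pow K|"
        "finite G" "|cyl K S G - V| <o |Pow K|"
        using W V unfolding thick_open_def by blast
      moreover have "cyl K S (F \<union> G) - W \<inter> V \<subseteq> (cyl K S F - W) \<union> (cyl K S G - V)"
        by (auto simp: cyl_def)
      ultimately show "\<exists>F. finite F \<and> |cyl K S F - W \<inter> V| <o |Pow K|"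
        using small_subset small_Un[OF assms] by (metis finite_UnI)
    qed
  next
    fix \<W> assume \<W>: "\<forall>W\<in>\<W>. thick_open K W"
    show "thick_open K (\<Union>\<W>)"
      unfolding thick_open_def
    proof (intro conjI ballI)
      show "\<Union>\<W> \<subseteq> Pow K"
        using \<W> by (auto simp: thick_open_def)
      fix S assume "S \<in> \<Union>\<W>"
      then obtain W F where "W \<in> \<W>" "finite F" "|cyl K S F - W| <o |Pow K|"
        using \<W> unfolding thick_open_def by blast
      then show "\<exists>F. finite F \<and> |cyl K S F - \<Union>\<W>| <o |Pow K|"
        using small_subset[of "cyl K S F - \<Union>\<W>" "cyl K S F - W"] by blast
    qed
  qed
  then show ?thesis
    by (simp add: thick_cube_def)
qed

lemma small_empty: "|{} :: 'a set| <o |Pow K|"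
  using card_of_empty card_of_Pow ordLeq_ordLess_trans by blast

lemma openin_thick_cyl:
  assumes "infinite K" "finite F"
  shows "openin (thick_cube K) (cyl K S F)"
proof -
  have "cyl K T F - cyl K S F = {}" if "T \<in> cyl K S F" for T
    using that by (auto simp: cyl_def)
  then show ?thesis
    using assms small_empty unfolding openin_thick_cube[OF assms(1)] thick_open_def
    by (metis (no_types, lifting) PowI cyl_def mem_Collect_eq subsetI)
qed

lemma topspace_thick_cube:
  assumes "infinite K"
  shows "topspace (thick_cube K) = Pow K"
proof
  show "topspace (thick_cube K) \<subseteq> Pow K"
    using openin_topspace[of "thick_cube K"]
    unfolding openin_thick_cube[OF assms] thick_open_def by blast
  show "Pow K \<subseteq> topspace (thick_cube K)"
    using openin_subset[OF openin_thick_cyl[OF assms, of "{}"]] by (auto simp: cyl_def)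
qed

lemma Hausdorff_thick_cube:
  assumes "infinite K"
  shows "Hausdorff_space (thick_cube K)"
  unfolding Hausdorff_space_def topspace_thick_cube[OF assms]
proof (intro allI impI)
  fix S T assume ST: "S \<in> Pow K \<and> T \<in> Pow K \<and> S \<noteq> T"
  then obtain x where x: "x \<in> S \<longleftrightarrow> x \<notin> T"
    by blast
  have "S \<in> cyl K S {x}" "T \<in> cyl K T {x}" "disjnt (cyl K S {x}) (cyl K T {x})"
    using ST x by (auto simp: cyl_def disjnt_def)
  then show "\<exists>U V. openin (thick_cube K) U \<and> openin (thick_cube K) V \<and>
      S \<in> U \<and> T \<in> V \<and> disjnt U V"
    using openin_thick_cyl[OF assms] by (meson finite.emptyI finite_insert)
qed

section \<open>The countable chain condition\<close>

text \<open>
  If \<open>W\<close> and \<open>V\<close> were disjoint, the intersection of the two cylinders, itself a cylinder around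
  \<open>T\<close>, would be covered by two sets that are too small for that.
\<close>

lemma overlapping_almost_cyl:
  assumes K: "infinite K" and fin: "finite F" "finite G"
    and W: "|cyl K S F - W| <o |Pow K|" and V: "|cyl K S' G - V| <o |Pow K|"
    and T: "T \<in> cyl K S F" "T \<in> cyl K S' G"
  shows "W \<inter> V \<noteq> {}"
proof
  assume "W \<inter> V = {}"
  then have "cyl K T (F \<union> G) \<subseteq> (cyl K S F - W) \<union> (cyl K S' G - V)"
    using T unfolding cyl_def by blast
  then have "|cyl K T (F \<union> G)| <o |Pow K|"
    using small_subset small_Un[OF K W V] by blast
  moreover have "|cyl K T (F \<union> G)| =o |Pow K|"
    using card_cyl[OF K] fin T by (simp add: cyl_def)
  ultimately show False
    using not_ordLess_ordIso by blast
qed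

lemma ccc_thick_cube:
  assumes K: "infinite K"
  shows "ccc_space (thick_cube K)"
  unfolding ccc_space_def
proof (intro allI impI)
  fix \<F> assume \<F>: "\<F> \<subseteq> {U. openin (thick_cube K) U} \<and> uncountable \<F>"
  define \<G> where "\<G> = \<F> - {{}}"
  have unc: "uncountable \<G>"
    using \<F> by (simp add: \<G>_def uncountable_minus_countable)
  have "\<exists>S F. S \<subseteq> K \<and> finite F \<and> |cyl K S F - W| <o |Pow K|" if "W \<in> \<G>" for W
  proof -
    have "thick_open K W" and "W \<noteq> {}"
      using that \<F> openin_thick_cube[OF K] by (auto simp: \<G>_def)
    then show ?thesis
      unfolding thick_open_def by (metis PowD ex_in_conv subsetD)
  qed
  then obtain S F where SF: "S W \<subseteq> K" "finite (F W)" "|cyl K (S W) (F W) - W| <o |Pow K|"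
    if "W \<in> \<G>" for W
    by metis
  have "\<exists>n. infinite {W \<in> \<G>. card (F W) = n}"
  proof (rule ccontr)
    assume "\<not> ?thesis"
    then have "countable (\<Union>n. {W \<in> \<G>. card (F W) = n})"
      by (intro countable_UN) (auto intro: countable_finite)
    moreover have "(\<Union>n. {W \<in> \<G>. card (F W) = n}) = \<G>"
      by auto
    ultimately show False
      using unc by simp
  qed
  then obtain n where "infinite {W \<in> \<G>. card (F W) = n}" ..
  then obtain I where I: "finite I" "card I = Suc (2 ^ n)" "I \<subseteq> {W \<in> \<G>. card (F W) = n}"
    using infinite_arbitrarily_large by blast
  obtain W V T where WV: "W \<in> I" "V \<in> I" "W \<noteq> V"
    and T: "T \<inter> F W = S W \<inter> F W" "T \<inter> F V = S V \<inter> F V"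
    by (rule cylinders_overlap[of I F n S]) (use I SF in auto)
  have "W \<in> \<G>" "V \<in> \<G>"
    using WV I by auto
  \<comment> \<open>\<open>T\<close> may have coordinates outside \<open>K\<close>; dropping them is harmless because \<open>S W\<close> and \<open>S V\<close>
     prescribe \<open>0\<close> there.\<close>
  moreover from this have "T \<inter> K \<in> cyl K (S W) (F W)" "T \<inter> K \<in> cyl K (S V) (F V)"
    using T SF by (auto simp: cyl_def)
  ultimately have "W \<inter> V \<noteq> {}"
    using overlapping_almost_cyl[OF K] SF by metis
  with \<open>W \<in> \<G>\<close> \<open>V \<in> \<G>\<close> \<open>W \<noteq> V\<close>
  show "\<exists>U\<in>\<F>. \<exists>V\<in>\<F>. U \<noteq> V \<and> U \<inter> V \<noteq> {}"
    by (auto simp: \<G>_def)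
qed

section \<open>Small subspaces\<close>

text \<open>
  The complement of \<open>Y\<close> omits too few points for the topology to notice, and the same remains true
  after adding the single point \<open>y\<close>; the resulting open set meets \<open>Y\<close> in \<open>y\<close> alone.
\<close>

lemma openin_thick_isolate:
  assumes K: "infinite K" and Y: "Y \<subseteq> Pow K" "|Y| <o |Pow K|" and "y \<in> Y"
  shows "openin (subtopology (thick_cube K) Y) {y}"
proof -
  have "|cyl K S {} - insert y (Pow K - Y)| <o |Pow K|" for S
    by (rule small_subset[OF _ Y(2)]) (auto simp: cyl_def)
  then have "openin (thick_cube K) (insert y (Pow K - Y))"
    using Y \<open>y \<in> Y\<close> unfolding openin_thick_cube[OF K] thick_open_def by blast
  moreover have "{y} = insert y (Pow K - Y) \<inter> Y"
    using \<open>y \<in> Y\<close> by auto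
  ultimately show ?thesis
    unfolding openin_subtopology by blast
qed

lemma not_ccc_if_singletons_open:
  assumes "uncountable Y" and "\<And>y. y \<in> Y \<Longrightarrow> openin X {y}"
  shows "\<not> ccc_space X"
proof
  have "uncountable ((\<lambda>y. {y}) ` Y)"
    using assms(1) by (simp add: countable_image_inj_eq)
  moreover have "(\<lambda>y. {y}) ` Y \<subseteq> {U. openin X U}"
    using assms(2) by auto
  moreover assume "ccc_space X"
  ultimately obtain U V where "U \<in> (\<lambda>y. {y}) ` Y" "V \<in> (\<lambda>y. {y}) ` Y" "U \<noteq> V" "U \<inter> V \<noteq> {}"
    unfolding ccc_space_def by meson
  then show False
    by blast
qed

lemma uncountable_Pow_infinite:
  assumes "infinite K"
  shows "uncountable (Pow K)"
proof
  assume "countable (Pow K)"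
  then have "|Pow K| \<le>o |UNIV :: nat set|"
    by (meson card_of_ordLeq countable_def subset_UNIV)
  also have "|UNIV :: nat set| \<le>o |K|"
    using assms infinite_iff_card_of_nat by blast
  finally have "|Pow K| \<le>o |K|" .
  then show False
    using card_of_Pow not_ordLess_ordLeq by blast
qed

theorem mainTheorem5:
  fixes \<kappa> :: "'k rel"
  assumes "Cinfinite \<kappa>"
  shows "\<exists>X :: 'k set topology.
           uncountable (topspace X) \<and> Hausdorff_space X \<and> ccc_space X \<and>
           (\<forall>Y \<subseteq> topspace X. uncountable Y \<and> |Y| <o ctwo ^c \<kappa> \<longrightarrow>
              \<not> ccc_space (subtopology X Y))"
proof (intro exI conjI allI impI)
  define K where "K = Field \<kappa>"
  have K: "infinite K"
    using assms by (simp add: K_def cinfinite_def)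
  have pow: "ctwo ^c \<kappa> =o |Pow K|"
    using ordIso_symmetric[OF card_of_Pow_Func[of K]]
    by (simp add: cexp_def ctwo_def K_def Field_card_of)
  show "uncountable (topspace (thick_cube K))"
    using uncountable_Pow_infinite[OF K] by (simp add: topspace_thick_cube[OF K])
  show "Hausdorff_space (thick_cube K)"
    by (rule Hausdorff_thick_cube[OF K])
  show "ccc_space (thick_cube K)"
    by (rule ccc_thick_cube[OF K])
  fix Y assume "Y \<subseteq> topspace (thick_cube K)" and Y: "uncountable Y \<and> |Y| <o ctwo ^c \<kappa>"
  then have "Y \<subseteq> Pow K" "|Y| <o |Pow K|"
    using pow ordLess_ordIso_trans by (auto simp: topspace_thick_cube[OF K])
  then show "\<not> ccc_space (subtopology (thick_cube K) Y)"
    using not_ccc_if_singletons_open openin_thick_isolate[OF K] Y by metis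
qed

end
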